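(* Let $C$ be a quad code of length $\ell>0$ containing $2^k$ codewords, and let $n\ge 0$ be an integer. Then $C$ is realizable in the EvenQuads-$2^n$ deck if and only if \[ n \ge \ell-k-1. \]
   Context: The EvenQuads-$2^n$ deck is the set $\mathbb{Z}_2^n$; its elements are called cards. A binary code of length $\ell$ is called a quad code if it is a linear subspace of $\mathbb{Z}_2^\ell$, every codeword has an even number of ones, and every nonzero codeword has at least 4 ones. Given a sequence of pairwise distinct cards $\vec{a}_1,\dots,\vec{a}_\ell\in\mathbb{Z}_2^n$, the code it realizes is \[ C=\{\boldsymbol{c}=c_1\cdots c_\ell\in\mathbb{Z}_2^\ell : \text{an even number of the } c_i \text{ equal } 1,\ c_1\vec{a}_1+\cdots+c_\ell\vec{a}_\ell=\vec 0\}. \] A code $C$ is realizable in the EvenQuads-$2^n$ deck if some sequence of $\ell$ pairwise distinct cards of $\mathbb{Z}_2^n$ realizes it. *)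

theory Defs
  imports "Jordan_Normal_Form.VS_Connect" "HOL-Library.Z2"
begin

definition deck :: "nat \<Rightarrow> bit vec set" where
  "deck n = carrier_vec n"

definition weight :: "bit vec \<Rightarrow> nat" where
  "weight c = card {i. i < dim_vec c \<and> c $ i = 1}"

definition quad_code :: "nat \<Rightarrow> bit vec set \<Rightarrow> bool" where
  "quad_code l C \<longleftrightarrow>
     VectorSpace.subspace class_ring C (module_vec TYPE(bit) l) \<and>
     (\<forall>c\<in>C. even (weight c)) \<and>
     (\<forall>c\<in>C. c \<noteq> 0\<^sub>v l \<longrightarrow> weight c \<ge> 4)"

text \<open>The dimension \<open>n\<close> is an argument because an empty list of cards does not
  determine in which space the linear combination is taken.\<close>

definition realized_code :: "nat \<Rightarrow> bit vec list \<Rightarrow> bit vec set" where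
  "realized_code n as =
     {c \<in> carrier_vec (length as).
        even (weight c) \<and>
        finsum_vec TYPE(bit) n (\<lambda>i. c $ i \<cdot>\<^sub>v as ! i) {..<length as} = 0\<^sub>v n}"

definition realizable :: "nat \<Rightarrow> nat \<Rightarrow> bit vec set \<Rightarrow> bool" where
  "realizable n l C \<longleftrightarrow>
     (\<exists>as. length as = l \<and> distinct as \<and> set as \<subseteq> deck n \<and> realized_code n as = C)"

end

theory Submission
  imports Defs
begin

text \<open>A list of cards of \<open>\<int>\<^sub>2\<^sup>n\<close> is an \<open>n \<times> l\<close> matrix, and the code it realizes is the
  common kernel of its \<open>n\<close> rows and of the all-ones functional.  The fibres of these
  \<open>n + 1\<close> functionals are cosets of the code, so \<open>2\<^sup>l \<le> 2\<^sup>n\<^sup>+\<^sup>1 2\<^sup>k\<close>.  Conversely, a linear code of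
  dimension \<open>k\<close> consisting of even words is cut out of the even words by \<open>l - k - 1\<close>
  functionals; distinctness of the resulting cards is automatic, since two equal cards would
  yield a codeword of weight 2.\<close>

section \<open>Bits and binary vectors\<close>

text \<open>Sums and products of bits stay in ring form, so that the laws for sums and scalar
  products apply to them.\<close>

declare add_bit_eq_xor [simp del] mult_bit_eq_and [simp del]

lemma bit_add_self [simp]: "x + x = (0 :: bit)"
  by (cases x) (simp_all add: add_bit_eq_xor)

lemma UNIV_bit: "(UNIV :: bit set) = {0, 1}"
  by (auto intro: bit.exhaust)

text \<open>Modulo 2 the sum counts the indices at which \<open>f\<close> is 1.\<close>

lemma sum_bit_eq_0_iff_even_card:
  fixes f :: "'a \<Rightarrow> bit"
  assumes "finite A"
  shows "sum f A = 0 \<longleftrightarrow> even (card {i \<in> A. f i = 1})"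
proof -
  have "sum f A = (\<Sum>i\<in>A. if f i = 1 then 1 else 0)"
    by (intro sum.cong) auto
  also have "\<dots> = of_nat (card {i \<in> A. f i = 1})"
    using assms by (simp add: sum.If_cases Int_def)
  also have "\<dots> = 0 \<longleftrightarrow> even (card {i \<in> A. f i = 1})"
    by (simp only: Z2.bit_eq_iff even_of_nat dvd_0_right simp_thms)
  finally show ?thesis .
qed

lemma bij_betw_list_of_vec:
  "bij_betw list_of_vec (carrier_vec l) {xs. set xs \<subseteq> UNIV \<and> length xs = l}"
  by (rule bij_betw_byWitness[where f' = vec_of_list])
    (auto simp: list_vec vec_list intro: carrier_vecI)

lemma finite_carrier_bit_vec [simp]: "finite (carrier_vec l :: bit vec set)"
  using bij_betw_finite[OF bij_betw_list_of_vec[where 'a = bit]]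
    finite_lists_length_eq[of "UNIV :: bit set" l] by (simp add: UNIV_bit)

lemma card_carrier_bit_vec: "card (carrier_vec l :: bit vec set) = 2 ^ l"
  using bij_betw_same_card[OF bij_betw_list_of_vec[where 'a = bit]]
    card_lists_length_eq[of "UNIV :: bit set" l] by (simp add: UNIV_bit numeral_2_eq_2)

lemma bit_vec_add_cancel:
  fixes x y :: "bit vec"
  assumes "x \<in> carrier_vec l" "y \<in> carrier_vec l"
  shows "x + (x + y) = y"
  using assms by (intro eq_vecI) (auto simp flip: add.assoc)

section \<open>Linear codes and their one-step extensions\<close>

text \<open>The only scalars are 0 and 1, so closure under addition together with the zero vector
  already describes a linear subspace.\<close>

definition linear_code :: "nat \<Rightarrow> bit vec set \<Rightarrow> bool" where
  "linear_code l C \<longleftrightarrow> C \<subseteq> carrier_vec l \<and> 0\<^sub>v l \<in> C \<and> (\<forall>x\<in>C. \<forall>y\<in>C. x + y \<in> C)"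

lemma linear_code_carrierD: "linear_code l C \<Longrightarrow> x \<in> C \<Longrightarrow> x \<in> carrier_vec l"
  by (auto simp: linear_code_def)

lemma linear_code_finite: "linear_code l C \<Longrightarrow> finite C"
  unfolding linear_code_def by (meson finite_carrier_bit_vec finite_subset)

lemma linear_code_add_iff:
  assumes "linear_code l C" "x \<in> C" "y \<in> carrier_vec l"
  shows "x + y \<in> C \<longleftrightarrow> y \<in> C"
  using assms bit_vec_add_cancel[of x l y] unfolding linear_code_def by (metis subsetD)

text \<open>Since \<open>v + v\<close> vanishes, the span of \<open>C\<close> and \<open>v\<close>
  is just \<open>C\<close> together with the coset of \<open>v\<close>.\<close>

lemma linear_code_adjoin:
  assumes C: "linear_code l C" and v: "v \<in> carrier_vec l"
  shows "linear_code l (C \<union> (+) v ` C)"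
proof -
  note carr = linear_code_carrierD[OF C]
  have sum: "x + y \<in> C" if "x \<in> C" "y \<in> C" for x y
    using C that by (auto simp: linear_code_def)
  have *: "x + (v + y) = v + (x + y)" "(v + x) + y = v + (x + y)" "(v + x) + (v + y) = x + y"
    if "x \<in> C" "y \<in> C" for x y
  proof -
    note xy = carr[OF that(1)] carr[OF that(2)]
    show "x + (v + y) = v + (x + y)" "(v + x) + y = v + (x + y)"
      using xy v by (auto intro!: eq_vecI simp: ac_simps)
    have "(v + x) + (v + y) = v + (v + (x + y))"
      using xy v by (auto intro!: eq_vecI simp: ac_simps)
    then show "(v + x) + (v + y) = x + y"
      using xy v by (simp add: bit_vec_add_cancel)
  qed
  show ?thesis
    unfolding linear_code_def
  proof (intro conjI ballI)
    show "C \<union> (+) v ` C \<subseteq> carrier_vec l"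
      using carr v by auto
    show "0\<^sub>v l \<in> C \<union> (+) v ` C"
      using C by (auto simp: linear_code_def)
    show "x + y \<in> C \<union> (+) v ` C" if "x \<in> C \<union> (+) v ` C" "y \<in> C \<union> (+) v ` C" for x y
      using that
    proof (elim UnE imageE)
      fix x' y' assume "x' \<in> C" "y' \<in> C" "x = v + x'" "y = v + y'"
      then show ?thesis
        by (simp add: * sum)
    qed (simp_all add: * sum)
  qed
qed

lemma adjoined_mem:
  assumes "linear_code l C" "v \<in> carrier_vec l"
  shows "v \<in> C \<union> (+) v ` C"
proof -
  have "v = v + 0\<^sub>v l" "0\<^sub>v l \<in> C"
    using assms by (simp_all add: linear_code_def)
  then show ?thesis
    by blast
qed

text \<open>The coset is a disjoint copy of \<open>C\<close>, because \<open>v + c\<close> in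
  \<open>C\<close> would force \<open>v\<close> in \<open>C\<close>.\<close>

lemma card_adjoin:
  assumes C: "linear_code l C" and v: "v \<in> carrier_vec l" "v \<notin> C"
  shows "card (C \<union> (+) v ` C) = 2 * card C"
proof -
  have "inj_on ((+) v) C"
    using bit_vec_add_cancel[OF v(1) linear_code_carrierD[OF C]] by (rule inj_on_inverseI)
  moreover have "v + c \<notin> C" if "c \<in> C" for c
    using linear_code_add_iff[OF C that v(1)] linear_code_carrierD[OF C that] v
    by (simp add: comm_add_vec)
  then have "C \<inter> (+) v ` C = {}"
    by auto
  ultimately show ?thesis
    using linear_code_finite[OF C] by (simp add: card_Un_disjoint card_image)
qed

section \<open>Linear functionals and separation\<close>

text \<open>The values of \<open>f\<close> on the unit vectors serve as the coordinates of
  \<open>w\<close>.\<close>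

lemma additive_eq_scalar_prod:
  fixes f :: "bit vec \<Rightarrow> bit"
  assumes add: "\<And>x y. x \<in> carrier_vec l \<Longrightarrow> y \<in> carrier_vec l \<Longrightarrow> f (x + y) = f x + f y"
  obtains w where "w \<in> carrier_vec l" "\<And>x. x \<in> carrier_vec l \<Longrightarrow> f x = w \<bullet> x"
proof
  let ?w = "vec l (\<lambda>i. f (unit_vec l i))"
  show "?w \<in> carrier_vec l"
    by simp
  have f0: "f (0\<^sub>v l) = 0"
    using add[of "0\<^sub>v l" "0\<^sub>v l"] by simp
  fix x :: "bit vec"
  assume x: "x \<in> carrier_vec l"
  \<comment> \<open>\<open>?p m\<close> keeps the first \<open>m\<close> coordinates of
    \<open>x\<close>; passing to \<open>Suc m\<close> adds a multiple of a unit vector.\<close>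
  let ?p = "\<lambda>m. vec l (\<lambda>i. if i < m then x $ i else 0)"
  have "m \<le> l \<Longrightarrow> f (?p m) = (\<Sum>i<m. ?w $ i * x $ i)" for m
  proof (induction m)
    case 0
    have "?p 0 = 0\<^sub>v l"
      by (intro eq_vecI) auto
    then show ?case
      by (simp add: f0)
  next
    case (Suc m)
    have zero: "0 \<cdot>\<^sub>v unit_vec l m = (0\<^sub>v l :: bit vec)"
      by (intro eq_vecI) auto
    have "?p (Suc m) = ?p m + x $ m \<cdot>\<^sub>v unit_vec l m"
      using Suc.prems by (intro eq_vecI) (auto simp: less_Suc_eq)
    then have "f (?p (Suc m)) = f (?p m) + f (x $ m \<cdot>\<^sub>v unit_vec l m)"
      by (simp add: add)
    also have "f (x $ m \<cdot>\<^sub>v unit_vec l m) = ?w $ m * x $ m"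
      using Suc.prems f0 zero by (cases "x $ m") auto
    finally show ?case
      using Suc by simp
  qed
  from this[of l] have "f (?p l) = ?w \<bullet> x"
    using x by (simp add: scalar_prod_def atLeast0LessThan)
  moreover have "?p l = x"
    using x by (intro eq_vecI) auto
  ultimately show "f x = ?w \<bullet> x"
    by simp
qed

text \<open>A subspace that is maximal among those avoiding \<open>v\<close> has index 2, so that the indicator
  function of its complement is additive.\<close>

lemma linear_code_separation:
  assumes C: "linear_code l C" and v: "v \<in> carrier_vec l" "v \<notin> C"
  obtains w where "w \<in> carrier_vec l" "\<And>c. c \<in> C \<Longrightarrow> w \<bullet> c = 0" "w \<bullet> v = 1"
proof -
  let ?F = "{M. linear_code l M \<and> v \<notin> M}"
  have "?F \<subseteq> Pow (carrier_vec l)"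
    by (auto simp: linear_code_def)
  then have "finite ?F"
    by (rule finite_subset) simp
  then obtain M where "M \<in> ?F" and CM: "C \<subseteq> M" and max: "\<And>N. N \<in> ?F \<Longrightarrow> M \<subseteq> N \<Longrightarrow> M = N"
    using finite_has_maximal2[of ?F C] C v(2) by (metis (no_types, lifting) mem_Collect_eq)
  then have M: "linear_code l M" and vM: "v \<notin> M"
    by auto
  \<comment> \<open>By maximality, adjoining \<open>x\<close> to \<open>M\<close> captures
    \<open>v\<close>, which places \<open>x\<close> and \<open>v\<close> in the same coset of
    \<open>M\<close>.\<close>
  have xv: "x + v \<in> M" if x: "x \<in> carrier_vec l" "x \<notin> M" for x
  proof -
    have "M \<noteq> M \<union> (+) x ` M"
      using adjoined_mem[OF M x(1)] x(2) by blast
    then have "v \<in> M \<union> (+) x ` M"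
      using max[of "M \<union> (+) x ` M"] linear_code_adjoin[OF M x(1)] by blast
    then obtain m where "m \<in> M" "v = x + m"
      using vM by blast
    then show ?thesis
      using bit_vec_add_cancel[OF x(1) linear_code_carrierD[OF M]] by simp
  qed
  \<comment> \<open>Both vectors lie in the coset of \<open>v\<close>, so \<open>v\<close> cancels
    from their sum: \<open>M\<close> has index 2.\<close>
  have both: "x + y \<in> M" if "x \<in> carrier_vec l" "y \<in> carrier_vec l" "x \<notin> M" "y \<notin> M" for x y
  proof -
    have "(x + v) + (y + v) = v + (v + (x + y))"
      using that v by (auto intro!: eq_vecI simp: ac_simps)
    then have "(x + v) + (y + v) = x + y"
      using that v by (simp add: bit_vec_add_cancel)
    then show ?thesis
      using M xv that unfolding linear_code_def by metis
  qed
  define f :: "bit vec \<Rightarrow> bit" where "f x = (if x \<in> M then 0 else 1)" for x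
  have "f (x + y) = f x + f y" if xy: "x \<in> carrier_vec l" "y \<in> carrier_vec l" for x y
    using linear_code_add_iff[OF M, of x y] linear_code_add_iff[OF M, of y x] both[OF xy] xy
    by (auto simp: f_def comm_add_vec[OF xy])
  then obtain w where "w \<in> carrier_vec l" "\<And>x. x \<in> carrier_vec l \<Longrightarrow> f x = w \<bullet> x"
    using additive_eq_scalar_prod by blast
  moreover have "f c = 0" if "c \<in> C" for c
    using that CM by (auto simp: f_def)
  moreover have "f v = 1"
    using vM by (simp add: f_def)
  ultimately show ?thesis
    using that[of w] v linear_code_carrierD[OF C] by metis
qed

section \<open>Realized codes as kernels of parity checks\<close>

abbreviation all_ones :: "nat \<Rightarrow> bit vec" where
  "all_ones l \<equiv> vec l (\<lambda>_. 1)"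

text \<open>This makes evenness of the weight one more linear equation, on a par with those given by
  the cards.\<close>

lemma even_weight_iff:
  assumes "c \<in> carrier_vec l"
  shows "even (weight c) \<longleftrightarrow> all_ones l \<bullet> c = 0"
proof -
  have "all_ones l \<bullet> c = (\<Sum>i\<in>{0..<l}. c $ i)"
    using assms by (simp add: scalar_prod_def)
  then show ?thesis
    using assms sum_bit_eq_0_iff_even_card[of "{0..<l}" "($) c"] by (simp add: weight_def)
qed

text \<open>Read coordinatewise, the vanishing combination of cards says that \<open>c\<close> is
  orthogonal to each row of the matrix whose columns are the cards.\<close>

lemma realized_code_eq:
  assumes "set as \<subseteq> carrier_vec n" "length as = l"
  shows "realized_code n as = {c \<in> carrier_vec l. all_ones l \<bullet> c = 0 \<and>
    (\<forall>j<n. vec l (\<lambda>i. as ! i $ j) \<bullet> c = 0)}"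
proof -
  have "finsum_vec TYPE(bit) n (\<lambda>i. c $ i \<cdot>\<^sub>v as ! i) {..<l} = 0\<^sub>v n
      \<longleftrightarrow> (\<forall>j<n. vec l (\<lambda>i. as ! i $ j) \<bullet> c = 0)" if c: "c \<in> carrier_vec l" for c
  proof -
    let ?s = "finsum_vec TYPE(bit) n (\<lambda>i. c $ i \<cdot>\<^sub>v as ! i) {..<l}"
    have as: "as ! i \<in> carrier_vec n" if "i < l" for i
      using that assms by (meson nth_mem subsetD)
    have "?s \<in> carrier_vec n"
      using as by (intro finsum_vec_closed) auto
    then have "?s = 0\<^sub>v n \<longleftrightarrow> (\<forall>j<n. ?s $ j = 0)"
      by (auto simp: vec_eq_iff carrier_vecD)
    moreover have "?s $ j = vec l (\<lambda>i. as ! i $ j) \<bullet> c" if j: "j < n" for j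
    proof -
      have "?s $ j = (\<Sum>i<l. (c $ i \<cdot>\<^sub>v as ! i) $ j)"
        using as j by (intro index_finsum_vec) auto
      also have "\<dots> = (\<Sum>i\<in>{0..<l}. as ! i $ j * c $ i)"
        using carrier_vecD[OF as] j by (intro sum.cong) (auto simp: mult.commute)
      finally show ?thesis
        using c by (simp add: scalar_prod_def)
    qed
    ultimately show ?thesis
      by simp
  qed
  then show ?thesis
    using assms even_weight_iff[of _ l] by (auto simp: realized_code_def)
qed

section \<open>Counting bound for the dimension of the deck\<close>

text \<open>An element \<open>x\<close> is recovered from the value \<open>h x\<close> and from its
  sum with a fixed representative of that fibre, and this sum lies in \<open>C\<close>.\<close>

lemma card_le_card_mult_fibre:
  fixes h :: "bit vec \<Rightarrow> 'a"
  assumes "A \<subseteq> carrier_vec l" "finite B" "h ` A \<subseteq> B" "finite C"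
    and fibre: "\<And>x y. x \<in> A \<Longrightarrow> y \<in> A \<Longrightarrow> h x = h y \<Longrightarrow> x + y \<in> C"
  shows "card A \<le> card B * card C"
proof -
  define r where "r = inv_into A h"
  have r: "r (h x) \<in> A" "h (r (h x)) = h x" if "x \<in> A" for x
    using that by (auto simp: r_def inv_into_into f_inv_into_f)
  let ?g = "\<lambda>x. (h x, r (h x) + x)"
  have "inj_on ?g A"
  proof (rule inj_onI)
    fix x y
    assume xy: "x \<in> A" "y \<in> A" "?g x = ?g y"
    then have "r (h x) + (r (h x) + x) = r (h x) + (r (h x) + y)"
      by (metis prod.inject)
    then show "x = y"
      using xy r(1)[of x] assms(1) by (metis bit_vec_add_cancel subsetD)
  qed
  moreover have "?g ` A \<subseteq> B \<times> C"
    using assms(3) r fibre by auto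
  ultimately have "card A \<le> card (B \<times> C)"
    using assms by (intro card_inj_on_le) auto
  then show ?thesis
    by (simp add: card_cartesian_product)
qed

lemma realized_code_dim_le:
  assumes as: "set as \<subseteq> carrier_vec n" "length as = l"
    and card: "card (realized_code n as) = 2 ^ k"
  shows "l \<le> n + k + 1"
proof -
  \<comment> \<open>Index \<open>n\<close> carries the parity functional, so that \<open>h\<close>
    packs all \<open>n + 1\<close> functionals into one vector.\<close>
  define W where "W j = (if j < n then vec l (\<lambda>i. as ! i $ j) else all_ones l)" for j
  define h where "h c = vec (Suc n) (\<lambda>j. W j \<bullet> c)" for c
  have W: "W j \<in> carrier_vec l" for j
    by (simp add: W_def)
  have code: "realized_code n as = {c \<in> carrier_vec l. \<forall>j<Suc n. W j \<bullet> c = 0}"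
    by (auto simp: realized_code_eq[OF as] W_def less_Suc_eq)
  have "x + y \<in> realized_code n as"
    if xy: "x \<in> carrier_vec l" "y \<in> carrier_vec l" "h x = h y" for x y
  proof -
    have "W j \<bullet> x = W j \<bullet> y" if "j < Suc n" for j
      using that arg_cong[OF xy(3), of "\<lambda>z. z $ j"] by (simp add: h_def)
    then show ?thesis
      using xy scalar_prod_add_distrib[OF W] by (simp add: code)
  qed
  moreover have "finite (realized_code n as)"
    by (simp add: code)
  ultimately have "card (carrier_vec l :: bit vec set)
      \<le> card (carrier_vec (Suc n) :: bit vec set) * card (realized_code n as)"
    by (intro card_le_card_mult_fibre[where h = h and l = l]) (auto simp: h_def)
  then have "(2::nat) ^ l \<le> 2 ^ (n + k + 1)"
    by (simp add: card_carrier_bit_vec card power_add mult_ac)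
  then show ?thesis
    by (rule power_le_imp_le_exp[rotated]) simp
qed

section \<open>Parity checks for codes of even words\<close>

text \<open>Adjoining an even word to \<open>C\<close> raises \<open>k\<close> by one and leaves one
  check fewer to find; a functional separating that word from \<open>C\<close> then cuts
  \<open>C\<close> out of the larger code.\<close>

lemma even_code_parity_checks:
  assumes "linear_code l C" "\<And>c. c \<in> C \<Longrightarrow> all_ones l \<bullet> c = 0"
    and "card C = 2 ^ k" "l \<le> n + k + 1"
  shows "\<exists>W. (\<forall>j<n. W j \<in> carrier_vec l) \<and>
    C = {c \<in> carrier_vec l. all_ones l \<bullet> c = 0 \<and> (\<forall>j<n. W j \<bullet> c = 0)}"
  using assms
proof (induction n arbitrary: C k)
  case (0 C k)
  note C = \<open>linear_code l C\<close>
  \<comment> \<open>A missing even word would extend \<open>C\<close> to at least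
    \<open>2 ^ l\<close> words, hence to the whole space, although the extension contains only even
    words.\<close>
  have "v \<in> C" if v: "v \<in> carrier_vec l" "all_ones l \<bullet> v = 0" for v
  proof (rule ccontr)
    assume "v \<notin> C"
    then have "v \<noteq> 0\<^sub>v l"
      using C by (auto simp: linear_code_def)
    \<comment> \<open>A positive length guarantees a word of odd weight, namely
      \<open>unit_vec l 0\<close>.\<close>
    then have l: "l > 0"
      using v(1) by (cases l) auto
    let ?D = "C \<union> (+) v ` C"
    have "card ?D = 2 * 2 ^ k"
      using card_adjoin[OF C v(1) \<open>v \<notin> C\<close>] 0 by simp
    also have "\<dots> \<ge> 2 ^ l"
      using power_increasing[of l "Suc k" "2::nat"] 0 by simp
    finally have "?D = carrier_vec l"
      using linear_code_adjoin[OF C v(1)]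
      by (intro card_seteq) (auto simp: card_carrier_bit_vec linear_code_def)
    then have "unit_vec l 0 \<in> ?D"
      by simp
    moreover have "all_ones l \<bullet> d = 0" if "d \<in> ?D" for d
      using that 0(2) v linear_code_carrierD[OF C]
      by (auto simp: scalar_prod_add_distrib[of _ l])
    ultimately have "all_ones l \<bullet> unit_vec l 0 = 0"
      by blast
    then show False
      using l by simp
  qed
  then show ?case
    using C 0(2) by (auto dest: linear_code_carrierD)
next
  case (Suc n C k)
  note C = \<open>linear_code l C\<close>
  let ?E = "{c \<in> carrier_vec l. all_ones l \<bullet> c = 0}"
  show ?case
  proof (cases "C = ?E")
    case True
    \<comment> \<open>\<open>C\<close> is the code of all even words, so all \<open>Suc n\<close>
      checks can be chosen as zero.\<close>
    then show ?thesis
      by (intro exI[of _ "\<lambda>_. 0\<^sub>v l"]) auto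
  next
    case False
    then obtain v where v: "v \<in> carrier_vec l" "all_ones l \<bullet> v = 0" "v \<notin> C"
      using Suc.prems(2) linear_code_carrierD[OF C] by blast
    let ?D = "C \<union> (+) v ` C"
    have "all_ones l \<bullet> d = 0" if "d \<in> ?D" for d
      using that Suc.prems(2) v linear_code_carrierD[OF C]
      by (auto simp: scalar_prod_add_distrib[of _ l])
    moreover have "card ?D = 2 ^ Suc k"
      using card_adjoin[OF C v(1,3)] Suc.prems by simp
    ultimately obtain W where W: "\<forall>j<n. W j \<in> carrier_vec l"
      and D: "?D = {c \<in> carrier_vec l. all_ones l \<bullet> c = 0 \<and> (\<forall>j<n. W j \<bullet> c = 0)}"
      using Suc.IH[of ?D "Suc k"] linear_code_adjoin[OF C v(1)] Suc.prems by auto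
    obtain w where w: "w \<in> carrier_vec l" "\<And>c. c \<in> C \<Longrightarrow> w \<bullet> c = 0" "w \<bullet> v = 1"
      using linear_code_separation[OF C v(1,3)] by blast
    \<comment> \<open>The check \<open>w\<close> vanishes on \<open>C\<close> and equals 1 on the
      adjoined coset, which singles out \<open>C\<close> inside \<open>?D\<close>.\<close>
    have "w \<bullet> (v + c) = 1" if "c \<in> C" for c
      using scalar_prod_add_distrib[OF w(1) v(1) linear_code_carrierD[OF C that]] w that by simp
    then have "C = {c \<in> ?D. w \<bullet> c = 0}"
      using w(2) by auto
    then have "C = {c \<in> carrier_vec l. all_ones l \<bullet> c = 0 \<and> (\<forall>j<Suc n. (W(n := w)) j \<bullet> c = 0)}"
      unfolding D by (auto simp: less_Suc_eq)
    moreover have "\<forall>j<Suc n. (W(n := w)) j \<in> carrier_vec l"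
      using W w(1) by simp
    ultimately show ?thesis
      by blast
  qed
qed

section \<open>Distinctness of the cards\<close>

lemma weight_unit_vec_add:
  assumes "i < l" "j < l" "i \<noteq> j"
  shows "weight (unit_vec l i + unit_vec l j) = 2"
proof -
  have "{m. m < dim_vec (unit_vec l i + unit_vec l j) \<and>
      (unit_vec l i + unit_vec l j) $ m = (1 :: bit)} = {i, j}"
    using assms by (auto simp: unit_vec_def split: if_splits)
  then show ?thesis
    using assms by (simp add: weight_def)
qed

lemma distinct_if_realized_weight_ge:
  assumes as: "set as \<subseteq> carrier_vec n" "length as = l"
    and wt: "\<And>c. c \<in> realized_code n as \<Longrightarrow> c \<noteq> 0\<^sub>v l \<Longrightarrow> weight c > 2"
  shows "distinct as"
  unfolding distinct_conv_nth
proof (intro allI impI)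
  fix i j
  assume ij: "i < length as" "j < length as" "i \<noteq> j"
  let ?c = "unit_vec l i + unit_vec l j :: bit vec"
  have wt2: "weight ?c = 2"
    using ij as by (intro weight_unit_vec_add) auto
  show "as ! i \<noteq> as ! j"
  proof
    assume "as ! i = as ! j"
    \<comment> \<open>Every row has equal entries at \<open>i\<close> and \<open>j\<close>, as has
      the all-ones vector, so the two contributions cancel.\<close>
    then have "?c \<in> realized_code n as"
      unfolding realized_code_eq[OF as] using ij as
      by (auto simp: scalar_prod_add_distrib[of _ l])
    moreover have "weight (0\<^sub>v l) = 0"
      by (simp add: weight_def)
    then have "?c \<noteq> 0\<^sub>v l"
      using wt2 by (metis zero_neq_numeral)
    ultimately show False
      using wt wt2 by force
  qed
qed

section \<open>Quad codes and realizability\<close>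

lemma quad_code_linear_code:
  assumes "quad_code l C"
  shows "linear_code l C"
proof -
  have "submodule class_ring C (module_vec TYPE(bit) l)"
    using assms by (auto simp: quad_code_def subspace_def)
  from submodule.subset[OF this] submodule.zero_closed[OF this] submodule.m_closed[OF this]
  show ?thesis
    by (simp add: linear_code_def module_vec_simps)
qed

lemma realizable_imp_dim_le:
  assumes "realizable n l C" "card C = 2 ^ k"
  shows "l \<le> n + k + 1"
  using assms realized_code_dim_le by (auto simp: realizable_def deck_def)

lemma quad_code_parity_checks:
  assumes "quad_code l C" "card C = 2 ^ k" "l \<le> n + k + 1"
  obtains W where "\<forall>j<n. W j \<in> carrier_vec l"
    and "C = {c \<in> carrier_vec l. all_ones l \<bullet> c = 0 \<and> (\<forall>j<n. W j \<bullet> c = 0)}"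
proof -
  have "linear_code l C"
    using assms(1) by (rule quad_code_linear_code)
  moreover have "all_ones l \<bullet> c = 0" if "c \<in> C" for c
    using that assms(1) calculation even_weight_iff[of c l]
    by (auto simp: quad_code_def linear_code_def)
  ultimately show thesis
    using even_code_parity_checks[OF _ _ assms(2,3)] that by blast
qed

lemma parity_checks_realized_code:
  assumes "\<forall>j<n. W j \<in> carrier_vec l"
  obtains as where "length as = l" "set as \<subseteq> carrier_vec n"
    and "realized_code n as =
      {c \<in> carrier_vec l. all_ones l \<bullet> c = 0 \<and> (\<forall>j<n. W j \<bullet> c = 0)}"
proof -
  \<comment> \<open>The checks become the rows, so the card at position \<open>i\<close> collects
    the \<open>i\<close>-th entries of all \<open>W j\<close>.\<close>
  define as where "as = map (\<lambda>i. vec n (\<lambda>j. W j $ i)) [0..<l]"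
  have as: "set as \<subseteq> carrier_vec n" "length as = l"
    by (auto simp: as_def)
  have "vec l (\<lambda>i. as ! i $ j) = W j" if "j < n" for j
    using that assms by (intro eq_vecI) (auto simp: as_def)
  then show thesis
    using that[OF as(2,1)] by (simp add: realized_code_eq[OF as] cong: conj_cong)
qed

lemma quad_code_realizable:
  assumes "quad_code l C" "card C = 2 ^ k" "l \<le> n + k + 1"
  shows "realizable n l C"
proof -
  obtain W where W: "\<forall>j<n. W j \<in> carrier_vec l"
    and C: "C = {c \<in> carrier_vec l. all_ones l \<bullet> c = 0 \<and> (\<forall>j<n. W j \<bullet> c = 0)}"
    using quad_code_parity_checks[OF assms] by blast
  obtain as where as: "length as = l" "set as \<subseteq> carrier_vec n" and code: "realized_code n as = C"
    using parity_checks_realized_code[OF W] unfolding C by blast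
  \<comment> \<open>Nonzero codewords have weight at least 4, whereas a repeated card would produce
    one of weight 2.\<close>
  have "distinct as"
    using assms(1) code
    by (intro distinct_if_realized_weight_ge[OF as(2,1)]) (force simp: quad_code_def)
  then show ?thesis
    using as code by (auto simp: realizable_def deck_def)
qed

theorem theorem3:
  fixes C :: "bit vec set" and l k n :: nat
  assumes "l > 0"
    and "quad_code l C"
    and "card C = 2 ^ k"
  shows "realizable n l C \<longleftrightarrow> int n \<ge> int l - int k - 1"
proof -
  \<comment> \<open>The additive form of the bound avoids truncated subtraction on the natural
    numbers.\<close>
  have "realizable n l C \<longleftrightarrow> l \<le> n + k + 1"
    using realizable_imp_dim_le quad_code_realizable assms by blast
  then show ?thesis
    by linarith
qed

end
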